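(* Let $n\ge2$ be an integer. The number of critical values of the shift $\delta$ contained in any interval $[a,b]$ is finite, and it vanishes if $b<1$.
   Context: For a real number $\delta$ (the shift) and $i,p\in\mathbb N$ put $\gamma_{i,p}=n(n+1)\delta(\delta-1)-2((n+1)\delta-n+p)i+2i^2+2p(p-1)$. The value $\delta$ is critical if there exist $i,p,j,q\in\mathbb N$ such that $p\le\lfloor i/2\rfloor$, $q\le\lfloor j/2\rfloor$, $i>j$, $\gamma_{i,p}=\gamma_{j,q}$ and $0\le p-q\le i-j$. *)

theory Defs
  imports Complex_Main
begin

definition gamma :: "nat \<Rightarrow> real \<Rightarrow> nat \<Rightarrow> nat \<Rightarrow> real" where
  "gamma n \<delta> i p =
     real n * (real n + 1) * \<delta> * (\<delta> - 1)
     - 2 * ((real n + 1) * \<delta> - real n + real p) * real i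
     + 2 * (real i)\<^sup>2 + 2 * real p * (real p - 1)"

text \<open>Indices range over the natural numbers including 0. The condition
  \<open>0 \<le> p - q \<le> i - j\<close> is read over the integers, to avoid truncated subtraction.\<close>

definition critical :: "nat \<Rightarrow> real \<Rightarrow> bool" where
  "critical n \<delta> \<longleftrightarrow>
     (\<exists>i p j q :: nat. p \<le> i div 2 \<and> q \<le> j div 2 \<and> i > j \<and>
        gamma n \<delta> i p = gamma n \<delta> j q \<and>
        0 \<le> int p - int q \<and> int p - int q \<le> int i - int j)"

end

theory Submission
  imports Defs
begin

text \<open>
  The quadratic term of \<^const>\<open>gamma\<close> in \<open>\<delta>\<close> depends on neither \<open>i\<close> nor \<open>p\<close>, so
  the equation \<open>\<gamma>\<^sub>i\<^sub>,\<^sub>p = \<gamma>\<^sub>j\<^sub>,\<^sub>q\<close> is linear in \<open>\<delta>\<close>, with leading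
  coefficient proportional to \<open>i - j > 0\<close>. Each quadruple of indices thus yields exactly one
  shift (\<open>gamma_eq_iff\<close>). With \<open>d = i - j\<close> and \<open>e = p - q\<close> this shift satisfies
  \<open>(n + 1) \<delta> = n + i + j - p + e (e - 1 - (j - 2 q)) / d\<close>.
  Since \<open>e\<close> is a natural number, \<open>e (e - 1) \<ge> 0\<close>, and since \<open>e \<le> d\<close> and \<open>2 q \<le> j\<close>, the
  remaining part of the fraction is at least \<open>- (j - 2 q)\<close>. Hence
  \<open>(n + 1) \<delta> \<ge> n + (i - p) + 2 q\<close> (\<open>critical_shift_lower_bound\<close>). As \<open>i \<ge> 1\<close> and
  \<open>p \<le> i div 2\<close>, the integer \<open>i - p\<close> is at least \<open>1\<close>, whence \<open>\<delta> \<ge> 1\<close>; moreover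
  \<open>i - p \<ge> i / 2\<close>, so an upper bound on \<open>\<delta>\<close> bounds \<open>i\<close> and with it all four indices.
\<close>

text \<open>The root \<open>\<delta>\<close> of the linear equation \<open>\<gamma>\<^sub>i\<^sub>,\<^sub>p = \<gamma>\<^sub>j\<^sub>,\<^sub>q\<close>, for \<open>i \<noteq> j\<close>.\<close>

definition shift_of_indices :: "nat \<Rightarrow> nat \<Rightarrow> nat \<Rightarrow> nat \<Rightarrow> nat \<Rightarrow> real" where
  "shift_of_indices n i p j q =
     (real n + real i + real j - real p
       + (real p - real q) * (real p + real q - real j - 1) / (real i - real j)) / (real n + 1)"

lemma gamma_eq_iff:
  assumes "j < i"
  shows "gamma n \<delta> i p = gamma n \<delta> j q \<longleftrightarrow> \<delta> = shift_of_indices n i p j q"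
proof -
  define d where "d = real i - real j"
  have d: "d > 0"
    using assms by (simp add: d_def)
  have i: "real i = real j + d"
    by (simp add: d_def)
  define c where "c = d * (real n + real i + real j - real p)
      + (real p - real q) * (real p + real q - real j - 1)"
  have "gamma n \<delta> i p - gamma n \<delta> j q = 2 * (c - d * ((real n + 1) * \<delta>))"
    unfolding gamma_def c_def i by (simp add: algebra_simps power2_eq_square)
  then have "gamma n \<delta> i p = gamma n \<delta> j q \<longleftrightarrow> d * ((real n + 1) * \<delta>) = c"
    by auto
  also have "\<dots> \<longleftrightarrow> \<delta> = c / d / (real n + 1)"
  proof -
    have "d \<noteq> 0" "real n + 1 \<noteq> 0"
      using d by linarith+
    then show ?thesis
      by (simp only: divide_divide_eq_left nonzero_eq_divide_eq mult_eq_0_iff simp_thms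
          mult.commute mult.left_commute)
  qed
  also have "c / d = real n + real i + real j - real p
      + (real p - real q) * (real p + real q - real j - 1) / d"
    using d by (simp add: c_def add_divide_distrib)
  finally show ?thesis
    unfolding shift_of_indices_def d_def .
qed

text \<open>
  Only the fraction in the definition needs an estimate. Its numerator equals
  \<open>e (e - 1) - e (j - 2 q)\<close> with \<open>e = p - q\<close>, so it can be negative, but dividing by
  \<open>i - j \<ge> e\<close> leaves a loss of at most \<open>j - 2 q\<close>, for which the summand \<open>j\<close>
  compensates.
\<close>

lemma critical_shift_lower_bound:
  assumes "j < i" "2 * q \<le> j" "q \<le> p" "p - q \<le> i - j"
  shows "(real n + 1) * shift_of_indices n i p j q \<ge> real n + (real i - real p) + 2 * real q"
proof -
  define d where "d = real i - real j"
  define e where "e = real p - real q"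
  have d: "d > 0" and e: "0 \<le> e" "e \<le> d"
    using assms by (auto simp: d_def e_def)
  \<comment> \<open>Integrality of the indices enters here: \<open>e\<close> is \<open>0\<close> or at least \<open>1\<close>.\<close>
  have "e * (e - 1) \<ge> 0"
  proof (cases "p = q")
    case False
    then have "e \<ge> 1"
      using assms by (simp add: e_def)
    then show ?thesis by simp
  qed (simp add: e_def)
  moreover have "e * (real j - 2 * real q) \<le> d * (real j - 2 * real q)"
    using e assms by (intro mult_right_mono) auto
  moreover have "e * (real p + real q - real j - 1) = e * (e - 1) - e * (real j - 2 * real q)"
    by (simp add: e_def algebra_simps)
  ultimately have "- (real j - 2 * real q) * d \<le> e * (real p + real q - real j - 1)"
    by (simp add: algebra_simps)
  then have "- (real j - 2 * real q) \<le> e * (real p + real q - real j - 1) / d"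
    using d by (simp only: pos_le_divide_eq)
  moreover have "(real n + 1) * shift_of_indices n i p j q = real n + real i + real j - real p
      + e * (real p + real q - real j - 1) / d"
    unfolding shift_of_indices_def d_def e_def by simp
  ultimately show ?thesis
    by linarith
qed

text \<open>
  Everything about a critical shift that the theorem uses. The inequality \<open>i \<le> 2 (n + 1) \<delta>\<close>
  is cruder than the lower bound gives, but it suffices to leave finitely many indices.
\<close>

lemma critical_imp_indices:
  assumes "critical n \<delta>"
  obtains i p j q where "\<delta> = shift_of_indices n i p j q" "p \<le> i" "j \<le> i" "q \<le> i"
    "real i \<le> 2 * (real n + 1) * \<delta>" "\<delta> \<ge> 1"
proof -
  obtain i p j q where *: "p \<le> i div 2" "q \<le> j div 2" "j < i"
    "gamma n \<delta> i p = gamma n \<delta> j q" "0 \<le> int p - int q" "int p - int q \<le> int i - int j"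
    using assms unfolding critical_def by blast
  have \<delta>: "\<delta> = shift_of_indices n i p j q"
    using *(3,4) gamma_eq_iff by blast
  have lb: "(real n + 1) * \<delta> \<ge> real n + (real i - real p) + 2 * real q"
    unfolding \<delta> using * by (intro critical_shift_lower_bound) auto
  have "2 * p \<le> i" "p + 1 \<le> i"
    using *(1,3) by auto
  then have p: "2 * real p \<le> real i" "real p + 1 \<le> real i" "0 \<le> real q"
    by linarith+
  have "(real n + 1) * \<delta> \<ge> real n + 1"
    using lb p by linarith
  then have "(real n + 1) * 1 \<le> (real n + 1) * \<delta>"
    by simp
  then have "\<delta> \<ge> 1"
    by (rule mult_left_le_imp_le) simp
  moreover have "real i \<le> 2 * (real n + 1) * \<delta>"
    unfolding mult.assoc using lb p by linarith
  moreover have "p \<le> i" "j \<le> i" "q \<le> i"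
    using *(1-3) by auto
  ultimately show ?thesis
    using \<delta> that by blast
qed

theorem corollary8:
  fixes n :: nat and a b :: real
  assumes "n \<ge> 2"
  shows "finite {\<delta> \<in> {a..b}. critical n \<delta>} \<and>
         (b < 1 \<longrightarrow> card {\<delta> \<in> {a..b}. critical n \<delta>} = 0)"
proof (intro conjI impI)
  define N where "N = nat \<lfloor>2 * (real n + 1) * b\<rfloor>"
  let ?f = "\<lambda>(i, p, j, q). shift_of_indices n i p j q"
  have "{\<delta> \<in> {a..b}. critical n \<delta>} \<subseteq> ?f ` ({..N} \<times> {..N} \<times> {..N} \<times> {..N})"
  proof
    fix \<delta> assume "\<delta> \<in> {\<delta> \<in> {a..b}. critical n \<delta>}"
    then have "\<delta> \<le> b" and crit: "critical n \<delta>"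
      by auto
    obtain i p j q where *: "\<delta> = shift_of_indices n i p j q" "p \<le> i" "j \<le> i" "q \<le> i"
      "real i \<le> 2 * (real n + 1) * \<delta>"
      by (rule critical_imp_indices[OF crit])
    have "2 * (real n + 1) * \<delta> \<le> 2 * (real n + 1) * b"
      using \<open>\<delta> \<le> b\<close> by (intro mult_left_mono) auto
    then have "i \<le> N"
      unfolding N_def using *(5) by (intro le_nat_floor) linarith
    then have "(i, p, j, q) \<in> {..N} \<times> {..N} \<times> {..N} \<times> {..N}"
      using * by auto
    then show "\<delta> \<in> ?f ` ({..N} \<times> {..N} \<times> {..N} \<times> {..N})"
      using *(1) by (force intro: rev_image_eqI)
  qed
  then show "finite {\<delta> \<in> {a..b}. critical n \<delta>}"
    by (rule finite_subset) auto
next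
  assume "b < 1"
  have "\<delta> \<ge> 1" if "critical n \<delta>" for \<delta>
    by (rule critical_imp_indices[OF that])
  then have "{\<delta> \<in> {a..b}. critical n \<delta>} = {}"
    using \<open>b < 1\<close> by fastforce
  then show "card {\<delta> \<in> {a..b}. critical n \<delta>} = 0"
    by (simp only: card.empty)
qed

end
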